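(* Let $F=\begin{bmatrix}1&1\\1&0\end{bmatrix}$ and $J=\begin{bmatrix}0&1\\1&0\end{bmatrix}$. Suppose there are $2\times 2$ non-negative integer matrices $A,B$ such that $AB=F^m$ for some $m\in\mathbb N$. Then there exist $k,l\in\mathbb N\cup\{0\}$ such that $k+l=m$ and either \[ A=F^k,\ B=F^l\quad\text{or}\quad A=F^kJ,\ B=JF^l . \]
   Context: $\mathbb N$ denotes the positive integers. $F$ is the Fibonacci substitution matrix. *)

theory Defs
  imports "Jordan_Normal_Form.Matrix"
begin

definition fib_mat :: "int mat" where
  "fib_mat = mat_of_rows_list 2 [[1, 1], [1, 0]]"

definition swap_mat :: "int mat" where
  "swap_mat = mat_of_rows_list 2 [[0, 1], [1, 0]]"

end

theory Submission
  imports Defs "Jordan_Normal_Form.Determinant"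
begin

text \<open>
  Write \<open>F\<close> and \<open>J\<close> for the two matrices.  Since \<open>det F = -1\<close>, every factorisation \<open>A B = F\<^sup>m\<close>
  forces \<open>det A = \<plusminus>1\<close>.  A non-negative integer matrix with determinant \<open>\<plusminus>1\<close> is either one of the
  permutation matrices \<open>1\<close>, \<open>J\<close>, or one of its rows dominates the other entrywise
  (\<open>nonneg_unimodular_2_cases\<close>): if the rows are incomparable, the two terms of the determinant
  differ by too much.  Multiplying on the right by the non-negative matrix \<open>B\<close> preserves
  row domination (\<open>row_le_mult\<close>), so the rows of \<open>A\<close> can only be ordered in the way the rows of
  \<open>F\<^sup>m\<close> are: for \<open>m = 0\<close> not at all, and for \<open>m > 0\<close> with the first row on top.

  This gives a descent on \<open>m\<close>.  When the first row of \<open>A\<close> dominates, \<open>C = F\<^sup>-\<^sup>1 A\<close>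
  is again non-negative, since \<open>F\<^sup>-\<^sup>1\<close> moves the second row up and puts the difference of the rows
  below it, and \<open>C B = F\<^sup>m\<^sup>-\<^sup>1\<close>.  The descent stops when \<open>A\<close> is \<open>1\<close> or \<open>J\<close>, and the number of
  factors \<open>F\<close> removed from \<open>A\<close> is the exponent \<open>k\<close>.
\<close>

section \<open>Two-by-two matrices\<close>

lemma times_mat_2_index:
  assumes "A \<in> carrier_mat 2 2" "B \<in> carrier_mat 2 2" "i < 2" "j < 2"
  shows "(A * B) $$ (i, j) = A $$ (i, 0) * B $$ (0, j) + A $$ (i, 1) * B $$ (1, j)"
  using assms by (auto simp: scalar_prod_def numeral_2_eq_2)

lemma eq_mat_2I:
  assumes "A \<in> carrier_mat 2 2" "B \<in> carrier_mat 2 2"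
    and "A $$ (0, 0) = B $$ (0, 0)" "A $$ (0, 1) = B $$ (0, 1)"
    and "A $$ (1, 0) = B $$ (1, 0)" "A $$ (1, 1) = B $$ (1, 1)"
  shows "A = B"
  using assms by (intro eq_matI) (auto simp: less_2_cases_iff)

lemma det_mat_2:
  fixes A :: "'a :: comm_ring_1 mat"
  assumes "A \<in> carrier_mat 2 2"
  shows "det A = A $$ (0, 0) * A $$ (1, 1) - A $$ (0, 1) * A $$ (1, 0)"
proof -
  have "det (mat_delete A i 0) = mat_delete A i 0 $$ (0, 0)" for i
    using assms by (intro det_single) (auto simp: mat_delete_def)
  then show ?thesis
    using assms laplace_expansion_column[OF assms, of 0]
    by (simp add: cofactor_def numeral_2_eq_2 mat_delete_def algebra_simps)
qed

lemma row_le_mult: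
  fixes A B :: "'a :: linordered_idom mat"
  assumes "A \<in> carrier_mat nr n" "B \<in> carrier_mat n nc"
    and "\<forall>k<n. \<forall>j<nc. B $$ (k, j) \<ge> 0"
    and "i < nr" "i' < nr" "j < nc" and "\<forall>k<n. A $$ (i, k) \<le> A $$ (i', k)"
  shows "(A * B) $$ (i, j) \<le> (A * B) $$ (i', j)"
  using assms by (auto simp: scalar_prod_def intro!: sum_mono mult_right_mono)

section \<open>The Fibonacci and swap matrices\<close>

lemma fib_mat_carrier [simp]: "fib_mat \<in> carrier_mat 2 2"
  by (auto simp: fib_mat_def mat_of_rows_list_def)

lemma fib_mat_index [simp]:
  "fib_mat $$ (0, 0) = 1" "fib_mat $$ (0, Suc 0) = 1"
  "fib_mat $$ (Suc 0, 0) = 1" "fib_mat $$ (Suc 0, Suc 0) = 0"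
  by (simp_all add: fib_mat_def mat_of_rows_list_def)

lemma swap_mat_carrier [simp]: "swap_mat \<in> carrier_mat 2 2"
  by (auto simp: swap_mat_def mat_of_rows_list_def)

lemma swap_mat_index [simp]:
  "swap_mat $$ (0, 0) = 0" "swap_mat $$ (0, Suc 0) = 1"
  "swap_mat $$ (Suc 0, 0) = 1" "swap_mat $$ (Suc 0, Suc 0) = 0"
  by (simp_all add: swap_mat_def mat_of_rows_list_def)

lemma swap_mat_involution: "swap_mat * swap_mat = 1\<^sub>m 2"
  by (rule eq_mat_2I)
    (auto simp: times_mat_2_index simp del: index_mult_mat(1) intro!: mult_carrier_mat[of _ 2 2])

definition fib_mat_inv :: "int mat" where
  "fib_mat_inv = mat_of_rows_list 2 [[0, 1], [1, -1]]"

lemma fib_mat_inv_carrier [simp]: "fib_mat_inv \<in> carrier_mat 2 2"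
  by (auto simp: fib_mat_inv_def mat_of_rows_list_def)

lemma fib_mat_inv_index [simp]:
  "fib_mat_inv $$ (0, 0) = 0" "fib_mat_inv $$ (0, Suc 0) = 1"
  "fib_mat_inv $$ (Suc 0, 0) = 1" "fib_mat_inv $$ (Suc 0, Suc 0) = -1"
  by (simp_all add: fib_mat_inv_def mat_of_rows_list_def)

lemma fib_mat_inv_left: "fib_mat_inv * fib_mat = 1\<^sub>m 2"
  by (rule eq_mat_2I)
    (auto simp: times_mat_2_index simp del: index_mult_mat(1) intro!: mult_carrier_mat[of _ 2 2])

lemma fib_mat_inv_right: "fib_mat * fib_mat_inv = 1\<^sub>m 2"
  by (rule eq_mat_2I)
    (auto simp: times_mat_2_index simp del: index_mult_mat(1) intro!: mult_carrier_mat[of _ 2 2])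

lemma fib_mat_dim [simp]: "dim_row fib_mat = 2" "dim_col fib_mat = 2"
  using fib_mat_carrier by (simp_all only: carrier_matD)

lemma fib_mat_pow_Suc: "fib_mat ^\<^sub>m Suc k = fib_mat * fib_mat ^\<^sub>m k"
proof (induction k)
  case 0
  show ?case by (simp add: left_mult_one_mat[of _ 2 2] right_mult_one_mat[of _ 2 2])
next
  case (Suc k)
  have "fib_mat ^\<^sub>m Suc (Suc k) = (fib_mat * fib_mat ^\<^sub>m k) * fib_mat"
    using Suc by simp
  also have "\<dots> = fib_mat * (fib_mat ^\<^sub>m k * fib_mat)"
    by (rule assoc_mult_mat[of _ 2 2 _ 2 _ 2]) simp_all
  finally show ?case by simp
qed

lemma det_fib_mat_pow: "det (fib_mat ^\<^sub>m m) = (- 1) ^ m"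
  by (induction m) (simp_all add: det_mult[of _ 2] det_mat_2[of fib_mat])

lemma fib_mat_pow_nonneg: "i < 2 \<Longrightarrow> j < 2 \<Longrightarrow> (fib_mat ^\<^sub>m m) $$ (i, j) \<ge> 0"
proof (induction m arbitrary: i j)
  case (Suc m)
  then show ?case
    by (auto simp: fib_mat_pow_Suc times_mat_2_index less_2_cases_iff
             simp del: index_mult_mat(1) pow_mat.simps)
qed auto

lemma fib_mat_pow_Suc_row_le:
  assumes "j < 2"
  shows "(fib_mat ^\<^sub>m Suc m) $$ (1, j) \<le> (fib_mat ^\<^sub>m Suc m) $$ (0, j)"
  using assms fib_mat_pow_nonneg[of 1 j m]
  by (simp add: fib_mat_pow_Suc times_mat_2_index del: index_mult_mat(1) pow_mat.simps)

text \<open>The reverse order of the rows would make them equal, and the determinant zero.\<close>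

lemma fib_mat_pow_row_not_le:
  "\<not> (\<forall>j<2. (fib_mat ^\<^sub>m m) $$ (0, j) \<le> (fib_mat ^\<^sub>m m) $$ (1, j))"
proof
  assume le: "\<forall>j<2. (fib_mat ^\<^sub>m m) $$ (0, j) \<le> (fib_mat ^\<^sub>m m) $$ (1, j)"
  show False
  proof (cases m)
    case 0
    with le show False by (auto dest: spec[of _ 0])
  next
    case (Suc n)
    have "(fib_mat ^\<^sub>m m) $$ (0, j) = (fib_mat ^\<^sub>m m) $$ (1, j)" if "j < 2" for j
      using le that fib_mat_pow_Suc_row_le[OF that, of n] unfolding Suc by (intro antisym) auto
    then have "det (fib_mat ^\<^sub>m m) = 0"
      by (simp add: det_mat_2)
    then show False
      by (simp add: det_fib_mat_pow)
  qed
qed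

section \<open>Descent\<close>

text \<open>
  If neither row dominates, then up to swapping the columns the matrix with rows \<open>(a, b)\<close>,
  \<open>(c, d)\<close> has \<open>a > c\<close> and \<open>d > b\<close>, so \<open>a d - b c \<ge> (c + 1) (b + 1) - b c = b + c + 1\<close>.
  Determinant \<open>\<plusminus>1\<close> therefore forces \<open>b = c = 0\<close> and \<open>a = d = 1\<close>.
\<close>

lemma int_incomparable_unimodular:
  fixes a b c d :: int
  assumes "0 \<le> b" "0 \<le> c" "c < a" "b < d" and "\<bar>a * d - b * c\<bar> = 1"
  shows "a = 1 \<and> b = 0 \<and> c = 0 \<and> d = 1"
proof -
  have "(c + 1) * (b + 1) \<le> a * d"
    using assms by (intro mult_mono) auto
  then have "b + c + 1 \<le> a * d - b * c"
    by (simp add: algebra_simps)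
  with assms have bc: "b = 0" "c = 0" by linarith+
  with assms have "a * d = 1"
    using mult_pos_pos[of a d] by simp
  with assms bc show ?thesis
    by (auto simp: zmult_eq_1_iff)
qed

lemma nonneg_unimodular_2_cases:
  fixes A :: "int mat"
  assumes A: "A \<in> carrier_mat 2 2" and nonneg: "\<forall>i<2. \<forall>j<2. A $$ (i, j) \<ge> 0"
    and det: "\<bar>det A\<bar> = 1"
  obtains (one) "A = 1\<^sub>m 2" | (swap) "A = swap_mat"
    | (upper) "\<forall>j<2. A $$ (1, j) \<le> A $$ (0, j)"
    | (lower) "\<forall>j<2. A $$ (0, j) \<le> A $$ (1, j)"
proof -
  define a b c d where abcd: "a = A $$ (0, 0)" "b = A $$ (0, 1)" "c = A $$ (1, 0)" "d = A $$ (1, 1)"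
  have pos: "a \<ge> 0" "b \<ge> 0" "c \<ge> 0" "d \<ge> 0"
    using nonneg by (auto simp: abcd)
  have D: "\<bar>a * d - b * c\<bar> = 1"
    using det det_mat_2[OF A] by (simp add: abcd)
  then have D': "\<bar>b * c - a * d\<bar> = 1" by linarith
  consider "c \<le> a \<and> d \<le> b" | "a \<le> c \<and> b \<le> d" | "c < a \<and> b < d" | "a < c \<and> d < b"
    by linarith
  then show thesis
  proof cases
    case 1
    then show thesis by (intro upper) (auto simp: abcd less_2_cases_iff)
  next
    case 2
    then show thesis by (intro lower) (auto simp: abcd less_2_cases_iff)
  next
    case 3
    with pos D have "a = 1 \<and> b = 0 \<and> c = 0 \<and> d = 1"
      by (intro int_incomparable_unimodular) auto
    then show thesis
      by (intro one eq_mat_2I A) (auto simp: abcd)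
  next
    case 4
    with pos D' have "b = 1 \<and> a = 0 \<and> d = 0 \<and> c = 1"
      by (intro int_incomparable_unimodular) auto
    then show thesis
      by (intro swap eq_mat_2I A) (auto simp: abcd)
  qed
qed

text \<open>
  Only \<open>A\<close> has to be taken apart: once what remains of it is \<open>1\<close> or \<open>J\<close>, it is its own inverse,
  and this determines \<open>B\<close>.
\<close>

lemma nonneg_factorisation_fib_mat_pow:
  fixes A B :: "int mat"
  assumes "A \<in> carrier_mat 2 2" "B \<in> carrier_mat 2 2"
    and "\<forall>i<2. \<forall>j<2. A $$ (i, j) \<ge> 0" "\<forall>i<2. \<forall>j<2. B $$ (i, j) \<ge> 0"
    and "A * B = fib_mat ^\<^sub>m m"
  shows "\<exists>k l. k + l = m \<and>
    ((A = fib_mat ^\<^sub>m k \<and> B = fib_mat ^\<^sub>m l) \<or>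
     (A = fib_mat ^\<^sub>m k * swap_mat \<and> B = swap_mat * fib_mat ^\<^sub>m l))"
  using assms
proof (induction m arbitrary: A rule: less_induct)
  case (less m)
  note A = less.prems(1) and B = less.prems(2) and nonneg = less.prems(3,4) and AB = less.prems(5)
  let ?P = "\<lambda>A m k l. k + l = m \<and>
    ((A = fib_mat ^\<^sub>m k \<and> B = fib_mat ^\<^sub>m l) \<or>
     (A = fib_mat ^\<^sub>m k * swap_mat \<and> B = swap_mat * fib_mat ^\<^sub>m l))"
  have "\<bar>det A * det B\<bar> = 1"
    unfolding det_mult[OF A B, symmetric] AB by (simp add: det_fib_mat_pow power_abs)
  then have "\<bar>det A\<bar> = 1"
    by (metis abs_zmult_eq_1)
  with A nonneg(1) show ?case
  proof (cases rule: nonneg_unimodular_2_cases)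
    case one
    with AB B have "?P A m 0 m" by (simp add: left_mult_one_mat[of _ 2 2])
    then show ?thesis by blast
  next
    case swap
    have "B = swap_mat * (swap_mat * B)"
      using B assoc_mult_mat[of swap_mat 2 2 swap_mat 2 B 2]
      by (simp add: swap_mat_involution left_mult_one_mat[of _ 2 2])
    with AB swap have "?P A m 0 m" by (simp add: left_mult_one_mat[of _ 2 2])
    then show ?thesis by blast
  next
    case upper
    then have rows: "(fib_mat ^\<^sub>m m) $$ (1, j) \<le> (fib_mat ^\<^sub>m m) $$ (0, j)" if "j < 2" for j
      using row_le_mult[OF A B nonneg(2), of 1 0 j] that AB by simp
    \<comment> \<open>The rows of \<open>F\<^sup>0\<close> are incomparable.\<close>
    have "m \<noteq> 0" using rows[of 1] by (intro notI) simp
    then obtain n where m: "m = Suc n" by (cases m) auto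
    define C where "C = fib_mat_inv * A"
    have C: "C \<in> carrier_mat 2 2" unfolding C_def using fib_mat_inv_carrier A by (rule mult_carrier_mat)
    have "\<forall>i<2. \<forall>j<2. C $$ (i, j) \<ge> 0"
      using A nonneg(1) upper
      by (auto simp: C_def times_mat_2_index less_2_cases_iff simp del: index_mult_mat(1))
    moreover have "C * B = fib_mat ^\<^sub>m n"
    proof -
      have "C * B = fib_mat_inv * (fib_mat * fib_mat ^\<^sub>m n)"
        using A B AB m unfolding C_def fib_mat_pow_Suc[symmetric]
        by (simp add: assoc_mult_mat[of _ 2 2 _ 2 _ 2])
      also have "\<dots> = (fib_mat_inv * fib_mat) * fib_mat ^\<^sub>m n"
        by (rule assoc_mult_mat[of _ 2 2 _ 2 _ 2, symmetric]) simp_all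
      finally show ?thesis by (simp add: fib_mat_inv_left left_mult_one_mat[of _ 2 2])
    qed
    ultimately obtain k l where kl: "?P C n k l"
      using less.IH[of n C] C B nonneg(2) m by blast
    have A_eq: "A = fib_mat * C"
      using A assoc_mult_mat[of fib_mat 2 2 fib_mat_inv 2 A 2]
      by (simp add: C_def fib_mat_inv_right left_mult_one_mat[of _ 2 2])
    have "fib_mat * (fib_mat ^\<^sub>m k * swap_mat) = fib_mat ^\<^sub>m Suc k * swap_mat"
      unfolding fib_mat_pow_Suc by (rule assoc_mult_mat[of _ 2 2 _ 2 _ 2, symmetric]) simp_all
    with kl have "?P A m (Suc k) l"
      unfolding A_eq m using fib_mat_pow_Suc[of k] by auto
    then show ?thesis by blast
  next
    case lower
    then have "(fib_mat ^\<^sub>m m) $$ (0, j) \<le> (fib_mat ^\<^sub>m m) $$ (1, j)" if "j < 2" for j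
      using row_le_mult[OF A B nonneg(2), of 0 1 j] that AB by simp
    with fib_mat_pow_row_not_le show ?thesis by blast
  qed
qed

theorem proposition6p16:
  fixes A B :: "int mat" and m :: nat
  assumes "A \<in> carrier_mat 2 2" and "B \<in> carrier_mat 2 2"
    and "\<forall>i<2. \<forall>j<2. A $$ (i, j) \<ge> 0"
    and "\<forall>i<2. \<forall>j<2. B $$ (i, j) \<ge> 0"
    and "m \<ge> 1"
    and "A * B = fib_mat ^\<^sub>m m"
  shows "\<exists>k l :: nat. k + l = m \<and>
    ((A = fib_mat ^\<^sub>m k \<and> B = fib_mat ^\<^sub>m l) \<or>
     (A = fib_mat ^\<^sub>m k * swap_mat \<and> B = swap_mat * fib_mat ^\<^sub>m l))"
  using nonneg_factorisation_fib_mat_pow assms(1-4,6) .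

end
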